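(* Let $\lambda>0$ and let $\hat\beta$ be the square-root Lasso, i.e. a minimizer over $\beta\in\mathbb{R}^p$ of $\|Y-X\beta\|_n+\lambda\|\beta\|_1$, where $Y=X\beta^0+\epsilon$. Let $\lambda_0>0$ satisfy $\lambda_0\|\epsilon\|_n\ge\|\epsilon^TX\|_\infty/n$. Suppose that for $\eta=\sqrt2-1$ one has $\lambda\eta>\lambda_0$ and $$\|\beta^0\|_1\le\|\epsilon\|_n\Big(\frac{\lambda\eta-\lambda_0}{2\lambda_0\lambda}\Big).$$ Define $$L:=\frac{\lambda\eta+\lambda_0}{\lambda\eta-\lambda_0}.$$ Then $$\|X(\hat\beta-\beta^0)\|_n^2\le\min_{S\subset\{1,\dots,p\}}\ \min_{\beta\in\mathbb{R}^p,\ S_\beta=S}\Big\{\|X(\beta-\beta^0)\|_n^2+\Big(\frac{\lambda\eta+\lambda_0}{\eta}\Big)^2\Big(\frac{\lambda\eta+\lambda_0}{2\lambda_0}\Big)^2\frac{\|\epsilon\|_n^2|S|}{\hat\phi^2(L,S)}\Big\}.$$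
   Context: $X$ is a fixed $n\times p$ real matrix of rank $n$, $Y\in\mathbb{R}^n$, $f^0=\mathbb{E}Y$, $\beta^0\in\mathbb{R}^p$ is a solution of $X\beta^0=f^0$, and $\epsilon:=Y-f^0$, so $Y=X\beta^0+\epsilon$ (the result is deterministic: it holds for any realization of $\epsilon$). For $v\in\mathbb{R}^n$, $\|v\|_n:=\sqrt{v^Tv/n}$. For $\beta\in\mathbb{R}^p$, $S_\beta:=\{j:\beta_j\ne0\}$. For $S\subset\{1,\dots,p\}$, $\beta_S\in\mathbb{R}^p$ has entries $\beta_j$ for $j\in S$ and $0$ otherwise. The compatibility constant, for $L>0$, is $$\hat\phi^2(L,S):=\min\{|S|\,\|X\beta_S-X\beta_{S^c}\|_n^2:\ \|\beta_S\|_1=1,\ \|\beta_{S^c}\|_1\le L\}.$$ Conventions: minima over $\beta$ with $S_\beta=S$ are understood as infima (i.e. the inequality holds for every $\beta$, with $S=S_\beta$); the term containing $|S|/\hat\phi^2(L,S)$ is $0$ if $S=\emptyset$ and $+\infty$ if $S\ne\emptyset$ and $\hat\phi(L,S)=0$. *)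

theory Defs
  imports "HOL-Analysis.Analysis"
begin

definition norm_n :: "real ^ 'n \<Rightarrow> real" where
  "norm_n v = sqrt ((v \<bullet> v) / real CARD('n))"

definition l1_norm :: "real ^ 'p \<Rightarrow> real" where
  "l1_norm b = (\<Sum>j\<in>UNIV. \<bar>b $ j\<bar>)"

definition active_set :: "real ^ 'p \<Rightarrow> 'p set" where
  "active_set b = {j. b $ j \<noteq> 0}"

definition restr :: "real ^ 'p \<Rightarrow> 'p set \<Rightarrow> real ^ 'p" where
  "restr b S = (\<chi> j. if j \<in> S then b $ j else 0)"

definition is_sqrt_lasso ::
  "real ^ 'p ^ 'n \<Rightarrow> real ^ 'n \<Rightarrow> real \<Rightarrow> real ^ 'p \<Rightarrow> bool" where
  "is_sqrt_lasso X Y lam bhat \<longleftrightarrow>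
     is_arg_min (\<lambda>b. norm_n (Y - X *v b) + lam * l1_norm b) (\<lambda>_. True) bhat"

text \<open>The squared compatibility constant. The infimum is attained when \<open>S\<close> is nonempty (see
  \<open>compat_sq_attained\<close>); for empty \<open>S\<close> the constraint set is empty and the value is irrelevant.\<close>

definition compat_sq :: "real ^ 'p ^ 'n \<Rightarrow> real \<Rightarrow> 'p set \<Rightarrow> real" where
  "compat_sq X L S =
     Inf ((\<lambda>b. real (card S) * (norm_n (X *v restr b S - X *v restr b (- S)))\<^sup>2) `
          {b. l1_norm (restr b S) = 1 \<and> l1_norm (restr b (- S)) \<le> L})"

text \<open>The extended-real value of \<open>c |S| / compat_sq X L S\<close>, with the convention that the whole term
  is \<open>0\<close> for empty \<open>S\<close> and infinite if \<open>S\<close> is nonempty and the compatibility constant vanishes.\<close>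

definition compat_term :: "real ^ 'p ^ 'n \<Rightarrow> real \<Rightarrow> 'p set \<Rightarrow> real \<Rightarrow> ereal" where
  "compat_term X L S c =
     (if S = {} then 0
      else if compat_sq X L S = 0 then \<infinity>
      else ereal (c * real (card S) / compat_sq X L S))"

lemma l1_norm_restr_split: "l1_norm b = l1_norm (restr b S) + l1_norm (restr b (- S))"
  unfolding l1_norm_def restr_def sum.distrib [symmetric] by (intro sum.cong) auto

lemma compat_sq_attained:
  fixes X :: "real ^ 'p ^ 'n"
  assumes S: "S \<noteq> {}" and L: "0 < L"
  shows "\<exists>b. l1_norm (restr b S) = 1 \<and> l1_norm (restr b (- S)) \<le> L \<and>
    compat_sq X L S = real (card S) * (norm_n (X *v restr b S - X *v restr b (- S)))\<^sup>2"
proof -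
  define A where "A = {b :: real ^ 'p. l1_norm (restr b S) = 1 \<and> l1_norm (restr b (- S)) \<le> L}"
  define f where
    "f = (\<lambda>b. real (card S) * (norm_n (X *v restr b S - X *v restr b (- S)))\<^sup>2)"
  have cr: "continuous_on UNIV (\<lambda>b. restr b T)" for T :: "'p set"
    unfolding restr_def
  proof (rule continuous_on_vec_lambda)
    fix j
    show "continuous_on UNIV (\<lambda>b. if j \<in> T then b $ j else (0::real))"
      by (cases "j \<in> T") (auto intro!: continuous_intros)
  qed
  have cl: "continuous_on UNIV (\<lambda>b. l1_norm (restr b T))" for T :: "'p set"
    unfolding l1_norm_def by (intro continuous_intros cr)
  have cX: "continuous_on UNIV (\<lambda>b. X *v restr b T)" for T :: "'p set"
    by (rule continuous_on_compose2 [OF matrix_vector_mult_linear_continuous_on cr]) auto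
  have cf: "continuous_on UNIV f"
    unfolding f_def norm_n_def by (intro continuous_intros cX) auto
  have "closed A"
    unfolding A_def by (intro closed_Collect_conj closed_Collect_eq closed_Collect_le
        cl continuous_intros)
  moreover have "bounded A"
  proof (rule boundedI)
    fix b assume "b \<in> A"
    then have "l1_norm b \<le> 1 + L"
      using l1_norm_restr_split [of b S] by (simp add: A_def)
    then show "norm b \<le> 1 + L"
      using norm_le_l1_cart [of b] by (simp add: l1_norm_def)
  qed
  ultimately have "compact A"
    by (simp add: compact_eq_bounded_closed)
  obtain s where s: "s \<in> S"
    using S by blast
  have "restr (axis s 1) S = axis s 1" "restr (axis s 1) (- S) = (0 :: real ^ 'p)"
    using s by (auto simp: restr_def vec_eq_iff axis_def)
  moreover have "l1_norm (axis s 1 :: real ^ 'p) = 1"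
    by (simp add: l1_norm_def axis_def if_distrib [of abs] cong: if_cong)
  ultimately have "axis s 1 \<in> A"
    using L by (simp add: A_def l1_norm_def)
  then have "A \<noteq> {}"
    by blast
  then obtain b where b: "b \<in> A" "\<And>c. c \<in> A \<Longrightarrow> f b \<le> f c"
    using continuous_attains_inf [OF \<open>compact A\<close> _ continuous_on_subset [OF cf subset_UNIV]]
    by auto
  have "Inf (f ` A) = f b"
    using b by (intro cInf_eq_minimum) auto
  then show ?thesis
    using b(1) by (intro exI [of _ b]) (simp add: compat_sq_def A_def f_def)
qed

end

theory Submission
  imports Defs
begin

text \<open>Comparing the objective at \<open>\<beta>hat\<close> and at \<open>\<beta>0\<close> bounds the residual norm
  \<open>norm_n (Y - X *v \<beta>hat)\<close> from above, and combining this comparison with Cauchy--Schwarz against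
  \<open>\<epsilon>\<close> and the duality of the \<open>l1\<close> and sup norms bounds it from below by
  \<open>(1 - \<eta>) * norm_n \<epsilon>\<close>, hence by \<open>\<eta> * norm_n \<epsilon>\<close>. In particular the residual does not vanish, so
  the objective has a first-order optimality condition at \<open>\<beta>hat\<close>: it is that of the ordinary Lasso
  with tuning parameter \<open>lam\<close> times the residual norm. The two bounds then put the problem in the
  range where the standard oracle inequality for the Lasso, via the compatibility constant, applies.\<close>

section \<open>Normalised inner product and Euclidean norm\<close>

definition inner_n :: "real ^ 'n \<Rightarrow> real ^ 'n \<Rightarrow> real" where
  "inner_n u v = (u \<bullet> v) / real CARD('n)"

lemma inner_n_commute: "inner_n u v = inner_n v u"
  by (simp add: inner_n_def inner_commute)

lemma inner_n_diff_left: "inner_n (u - v) w = inner_n u w - inner_n v w"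
  by (simp add: inner_n_def inner_diff_left diff_divide_distrib)

lemma inner_n_diff_right: "inner_n u (v - w) = inner_n u v - inner_n u w"
  by (simp add: inner_n_def inner_diff_right diff_divide_distrib)

lemma inner_n_scaleR_left: "inner_n (c *\<^sub>R u) v = c * inner_n u v"
  by (simp add: inner_n_def)

lemma inner_n_scaleR_right: "inner_n u (c *\<^sub>R v) = c * inner_n u v"
  by (simp add: inner_n_def)

lemmas inner_n_simps = inner_n_diff_left inner_n_diff_right
  inner_n_scaleR_left inner_n_scaleR_right

lemma norm_n_nonneg: "0 \<le> norm_n v"
  by (simp add: norm_n_def)

lemma norm_n_power2: "(norm_n v)\<^sup>2 = inner_n v v"
  by (simp add: norm_n_def inner_n_def)

lemma norm_n_conv_norm: "norm_n (v :: real ^ 'n) = norm v / sqrt (real CARD('n))"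
  by (simp add: norm_n_def norm_eq_sqrt_inner real_sqrt_divide)

lemma norm_n_eq_0_iff: "norm_n v = 0 \<longleftrightarrow> v = 0"
  by (simp add: norm_n_conv_norm)

lemma norm_n_scaleR: "norm_n (c *\<^sub>R v) = \<bar>c\<bar> * norm_n v"
  by (simp add: norm_n_conv_norm)

lemma inner_n_le_norm_n: "inner_n u v \<le> norm_n u * norm_n v"
  using norm_cauchy_schwarz [of u v]
  by (simp add: inner_n_def norm_n_conv_norm divide_right_mono)

section \<open>The l1 norm, its splitting over coordinates and its duality with the sup norm\<close>

lemma l1_norm_nonneg: "0 \<le> l1_norm b"
  by (simp add: l1_norm_def sum_nonneg)

lemma l1_norm_eq_0_iff: "l1_norm b = 0 \<longleftrightarrow> b = 0"
  by (simp add: l1_norm_def sum_nonneg_eq_0_iff vec_eq_iff)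

lemma l1_norm_triangle: "l1_norm (a + b) \<le> l1_norm a + l1_norm b"
  unfolding l1_norm_def sum.distrib [symmetric] by (intro sum_mono) (simp add: abs_triangle_ineq)

lemma l1_norm_scaleR: "l1_norm (c *\<^sub>R b) = \<bar>c\<bar> * l1_norm b"
  by (simp add: l1_norm_def abs_mult sum_distrib_left)

lemma l1_norm_minus: "l1_norm (- b) = l1_norm b"
  by (simp add: l1_norm_def)

lemma l1_norm_triangle_diff: "l1_norm (a - b) \<le> l1_norm a + l1_norm b"
  using l1_norm_triangle [of a "- b"] by (simp add: l1_norm_minus)

text \<open>Coordinatewise: on the active set this is the reverse triangle inequality; off it
  \<open>b\<close> vanishes, so both sides contribute exactly minus the modulus of the entry of
  \<open>c\<close>.\<close>

lemma l1_norm_diff_le_restr: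
  "l1_norm b - l1_norm c \<le>
    l1_norm (restr (c - b) (active_set b)) - l1_norm (restr (c - b) (- active_set b))"
  unfolding l1_norm_def sum_subtractf [symmetric]
  by (intro sum_mono) (auto simp: restr_def active_set_def)

text \<open>Hoelder's inequality for the sup and l1 norms, after moving \<open>X\<close> to the
  other side of the inner product. It controls the noise.\<close>

lemma inner_n_matrix_le_l1_norm:
  fixes X :: "real ^ 'p ^ 'n"
  assumes "infnorm (e v* X) / real CARD('n) \<le> K"
  shows "inner_n e (X *v d) \<le> K * l1_norm d"
proof -
  have "(e v* X) \<bullet> d \<le> (\<Sum>j\<in>UNIV. infnorm (e v* X) * \<bar>d $ j\<bar>)"
    unfolding inner_vec_def
  proof (rule sum_mono)
    fix j
    have "(e v* X) $ j * d $ j \<le> \<bar>(e v* X) $ j\<bar> * \<bar>d $ j\<bar>"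
      by (metis abs_ge_self abs_mult)
    also have "\<dots> \<le> infnorm (e v* X) * \<bar>d $ j\<bar>"
      by (intro mult_right_mono component_le_infnorm_cart) auto
    finally show "(e v* X) $ j \<bullet> d $ j \<le> infnorm (e v* X) * \<bar>d $ j\<bar>"
      by simp
  qed
  then have "inner_n e (X *v d) \<le> infnorm (e v* X) / real CARD('n) * l1_norm d"
    by (simp add: inner_n_def l1_norm_def dot_lmul_matrix sum_distrib_left [symmetric]
        divide_right_mono)
  also have "\<dots> \<le> K * l1_norm d"
    by (intro mult_right_mono assms l1_norm_nonneg)
  finally show ?thesis .
qed

section \<open>First-order optimality of the square-root Lasso and the compatibility
  inequality\<close>

lemma is_sqrt_lasso_le:
  assumes "is_sqrt_lasso X Y lam bhat"
  shows "norm_n (Y - X *v bhat) + lam * l1_norm bhat \<le> norm_n (Y - X *v b) + lam * l1_norm b"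
  using assms unfolding is_sqrt_lasso_def is_arg_min_linorder by auto

text \<open>Letting \<open>s\<close> tend to 0 from the right; this takes the place of
  differentiating the objective.\<close>

lemma le_of_le_add_mult_small:
  fixes a b c :: real
  assumes "\<And>s. 0 < s \<Longrightarrow> s < 1 \<Longrightarrow> a \<le> b + s * c"
  shows "a \<le> b"
proof (rule tendsto_lowerbound)
  show "((\<lambda>s. b + s * c) \<longlongrightarrow> b) (at_right 0)"
    by (auto intro!: tendsto_eq_intros)
  show "\<forall>\<^sub>F s in at_right 0. a \<le> b + s * c"
    unfolding eventually_at_right_field using assms by (intro exI [of _ 1]) auto
qed simp

text \<open>Compare \<open>bhat\<close> with the point a fraction \<open>s\<close> along the segment
  to \<open>b\<close>: the penalty is bounded by convexity, the residual norm is expanded to first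
  order in \<open>s\<close>, and then \<open>s\<close> tends to 0.\<close>

lemma sqrt_lasso_optimality:
  assumes lasso: "is_sqrt_lasso X Y lam bhat" and lam: "0 \<le> lam"
    and res: "norm_n (Y - X *v bhat) \<noteq> 0"
  shows "inner_n (Y - X *v bhat) (X *v (b - bhat))
    \<le> lam * norm_n (Y - X *v bhat) * (l1_norm b - l1_norm bhat)"
proof -
  define r where "r = Y - X *v bhat"
  define v where "v = X *v (b - bhat)"
  define D where "D = lam * (l1_norm b - l1_norm bhat)"
  have r: "norm_n r > 0"
    using res norm_n_nonneg [of r] by (simp add: r_def)
  have "inner_n r v \<le> norm_n r * D + s * ((norm_n v)\<^sup>2 / 2)" if s: "0 < s" "s < 1" for s
  proof -
    have "l1_norm (bhat + s *\<^sub>R (b - bhat)) = l1_norm ((1 - s) *\<^sub>R bhat + s *\<^sub>R b)"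
      by (simp add: algebra_simps)
    also have "\<dots> \<le> (1 - s) * l1_norm bhat + s * l1_norm b"
      using l1_norm_triangle [of "(1 - s) *\<^sub>R bhat" "s *\<^sub>R b"] s by (simp add: l1_norm_scaleR)
    finally have "lam * l1_norm (bhat + s *\<^sub>R (b - bhat)) \<le> lam * l1_norm bhat + s * D"
      using mult_left_mono [OF _ lam] by (fastforce simp: D_def algebra_simps)
    moreover have eq: "Y - X *v (bhat + s *\<^sub>R (b - bhat)) = r - s *\<^sub>R v"
      by (simp add: r_def v_def matrix_vector_right_distrib matrix_vector_mult_scaleR)
    ultimately have le: "norm_n r - s * D \<le> norm_n (r - s *\<^sub>R v)"
      using is_sqrt_lasso_le [OF lasso, of "bhat + s *\<^sub>R (b - bhat)"]
      unfolding eq by (simp add: r_def)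
    \<comment> \<open>This passes from the norm of the moved residual to its square, which is a
      polynomial in \<open>s\<close>. The loss is only of order \<open>s\<close> squared.\<close>
    have "2 * norm_n r * norm_n (r - s *\<^sub>R v) \<le> (norm_n r)\<^sup>2 + (norm_n (r - s *\<^sub>R v))\<^sup>2"
      by (rule sum_squares_bound)
    also have "(norm_n (r - s *\<^sub>R v))\<^sup>2 = (norm_n r)\<^sup>2 - 2 * s * inner_n r v + s\<^sup>2 * (norm_n v)\<^sup>2"
      unfolding norm_n_power2 inner_n_simps
      by (simp add: inner_n_commute [of v r] power2_eq_square algebra_simps)
    finally have "2 * norm_n r * (norm_n r - s * D)
        \<le> 2 * (norm_n r)\<^sup>2 - 2 * s * inner_n r v + s\<^sup>2 * (norm_n v)\<^sup>2"
      using mult_left_mono [OF le, of "2 * norm_n r"] r by linarith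
    then have "s * inner_n r v \<le> s * (norm_n r * D + s * ((norm_n v)\<^sup>2 / 2))"
      by (simp add: power2_eq_square algebra_simps)
    then show ?thesis
      using s by simp
  qed
  then have "inner_n r v \<le> norm_n r * D"
    by (rule le_of_le_add_mult_small)
  then show ?thesis
    by (simp add: r_def v_def D_def ac_simps)
qed

text \<open>The quadratic form and the cone condition are homogeneous, so \<open>d\<close> can be
  rescaled to a competitor in the infimum defining \<open>compat_sq\<close>.\<close>

lemma compat_sq_mult_l1_norm_le:
  fixes X :: "real ^ 'p ^ 'n"
  assumes cone: "l1_norm (restr d (- S)) \<le> L * l1_norm (restr d S)"
  shows "compat_sq X L S * (l1_norm (restr d S))\<^sup>2 \<le> real (card S) * (norm_n (X *v d))\<^sup>2"
proof (cases "l1_norm (restr d S) = 0")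
  case True
  then show ?thesis by simp
next
  case False
  define m where "m = l1_norm (restr d S)"
  have m: "m > 0"
    using False l1_norm_nonneg [of "restr d S"] by (simp add: m_def)
  \<comment> \<open>The sign flip off \<open>S\<close> undoes the minus sign in
    \<open>compat_sq\<close>, so that the competitor yields \<open>X *v d\<close> up to the factor
    \<open>1 / m\<close>.\<close>
  define b where "b = (1 / m) *\<^sub>R (restr d S - restr d (- S))"
  have bS: "restr b S = (1 / m) *\<^sub>R restr d S"
    and bC: "restr b (- S) = (- (1 / m)) *\<^sub>R restr d (- S)"
    by (auto simp: b_def restr_def vec_eq_iff)
  have "restr d S + restr d (- S) = d"
    by (auto simp: restr_def vec_eq_iff)
  then have Xb: "X *v restr b S - X *v restr b (- S) = (1 / m) *\<^sub>R (X *v d)"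
    unfolding bS bC
    by (metis (no_types) diff_minus_eq_add matrix_vector_mult_scaleR matrix_vector_right_distrib
        scaleR_minus_left scaleR_right_distrib)
  have "compat_sq X L S \<le> real (card S) * (norm_n (X *v restr b S - X *v restr b (- S)))\<^sup>2"
    unfolding compat_sq_def
  proof (rule cInf_lower)
    have "l1_norm (restr b S) = 1"
      using m by (simp add: bS l1_norm_scaleR flip: m_def)
    moreover have "l1_norm (restr b (- S)) \<le> L"
      using m cone unfolding bC l1_norm_scaleR by (simp add: field_simps flip: m_def)
    ultimately show "real (card S) * (norm_n (X *v restr b S - X *v restr b (- S)))\<^sup>2 \<in>
      (\<lambda>b. real (card S) * (norm_n (X *v restr b S - X *v restr b (- S)))\<^sup>2) `
        {b. l1_norm (restr b S) = 1 \<and> l1_norm (restr b (- S)) \<le> L}"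
      by blast
  qed (auto intro!: bdd_belowI2 [where m = 0])
  also have "\<dots> = real (card S) * (norm_n (X *v d))\<^sup>2 / m\<^sup>2"
    by (simp add: Xb norm_n_scaleR power_mult_distrib power_divide)
  finally show ?thesis
    using m by (simp add: field_simps flip: m_def)
qed

lemma compat_sq_nonneg:
  assumes "S \<noteq> {}" "0 < L"
  shows "0 \<le> compat_sq X L S"
  using compat_sq_attained [OF assms, of X] by auto

section \<open>The oracle inequality\<close>

theorem theorem1p4p1:
  fixes X :: "real ^ 'p ^ 'n"
    and Y f0 \<epsilon> :: "real ^ 'n"
    and \<beta>0 \<beta>hat :: "real ^ 'p"
    and lam lam0 \<eta> L :: real
  assumes "rank X = CARD('n)"
    and "X *v \<beta>0 = f0"
    and "\<epsilon> = Y - f0"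
    and "lam > 0"
    and "is_sqrt_lasso X Y lam \<beta>hat"
    and "lam0 > 0"
    and "lam0 * norm_n \<epsilon> \<ge> infnorm (\<epsilon> v* X) / real CARD('n)"
    and "\<eta> = sqrt 2 - 1"
    and "lam * \<eta> > lam0"
    and "l1_norm \<beta>0 \<le> norm_n \<epsilon> * ((lam * \<eta> - lam0) / (2 * lam0 * lam))"
    and "L = (lam * \<eta> + lam0) / (lam * \<eta> - lam0)"
  shows "ereal ((norm_n (X *v (\<beta>hat - \<beta>0)))\<^sup>2) \<le>
    (INF S \<in> (UNIV :: 'p set set). INF \<beta> \<in> {\<beta>. active_set \<beta> = S}.
       ereal ((norm_n (X *v (\<beta> - \<beta>0)))\<^sup>2) +
       compat_term X L S
         (((lam * \<eta> + lam0) / \<eta>)\<^sup>2 * ((lam * \<eta> + lam0) / (2 * lam0))\<^sup>2 * (norm_n \<epsilon>)\<^sup>2))"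
proof (intro INF_greatest)
  fix S :: "'p set" and \<beta> :: "real ^ 'p"
  assume "\<beta> \<in> {\<beta>. active_set \<beta> = S}"
  then have S: "active_set \<beta> = S"
    by simp
  \<comment> \<open>\<open>c\<close> and \<open>c'\<close> are \<open>lam + lam0 / \<eta>\<close>
    and \<open>lam - lam0 / \<eta>\<close>, the weights of the l1 error on and off \<open>S\<close>;
    their quotient is \<open>L\<close>. \<open>U\<close> will bound the residual norm relative to
    \<open>\<sigma>\<close>.\<close>
  define c where "c = (lam * \<eta> + lam0) / \<eta>"
  define c' where "c' = (lam * \<eta> - lam0) / \<eta>"
  define U where "U = (lam * \<eta> + lam0) / (2 * lam0)"
  define \<sigma> where "\<sigma> = norm_n \<epsilon>"
  define r where "r = Y - X *v \<beta>hat"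
  define a where "a = norm_n r"
  define P where "P = norm_n (X *v (\<beta>hat - \<beta>0))"
  define Q where "Q = norm_n (X *v (\<beta>hat - \<beta>))"
  define R where "R = norm_n (X *v (\<beta> - \<beta>0))"
  define m where "m = l1_norm (restr (\<beta>hat - \<beta>) S)"
  define m' where "m' = l1_norm (restr (\<beta>hat - \<beta>) (- S))"
  have \<sigma>: "0 \<le> \<sigma>" and a: "0 \<le> a" and m: "0 \<le> m" "0 \<le> m'"
    by (simp_all add: \<sigma>_def a_def m_def m'_def norm_n_nonneg l1_norm_nonneg)
  have "sqrt 2 > 1"
    by simp
  moreover have "sqrt 2 < 3 / 2"
    by (rule real_less_lsqrt) (auto simp: power2_eq_square)
  ultimately have \<eta>: "0 < \<eta>" "\<eta> < 1 / 2"
    using assms(8) by auto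
  have pos: "0 < c" "0 < c'" "0 < U" "0 < L"
    using assms(4,6,9) \<eta> by (auto simp: c_def c'_def U_def assms(11) intro!: divide_pos_pos add_pos_pos)
  have L: "L = c / c'"
    using \<eta> by (simp add: assms(11) c_def c'_def)
  have \<epsilon>: "\<epsilon> = Y - X *v \<beta>0"
    using assms(2,3) by simp
  have r\<epsilon>: "r = \<epsilon> - X *v (\<beta>hat - \<beta>0)"
    by (simp add: r_def \<epsilon> matrix_vector_mult_diff_distrib)
  have dual: "inner_n \<epsilon> (X *v d) \<le> lam0 * \<sigma> * l1_norm d" for d
    unfolding \<sigma>_def by (rule inner_n_matrix_le_l1_norm) (use assms(7) in simp)
  have basic: "a + lam * l1_norm \<beta>hat \<le> \<sigma> + lam * l1_norm \<beta>0"
    using is_sqrt_lasso_le [OF assms(5), of \<beta>0] by (simp add: a_def r_def \<sigma>_def \<epsilon>)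
  have b0: "2 * lam0 * lam * l1_norm \<beta>0 \<le> \<sigma> * (lam * \<eta> - lam0)"
    using assms(4,6,10) by (simp add: \<sigma>_def field_simps)
  \<comment> \<open>The claim in real numbers: the first alternative suffices because the
    compatibility term is nonnegative; in the second, a vanishing constant makes the term
    infinite.\<close>
  have "P\<^sup>2 \<le> R\<^sup>2 \<or> S \<noteq> {} \<and> (compat_sq X L S \<noteq> 0 \<longrightarrow>
      P\<^sup>2 \<le> R\<^sup>2 + c\<^sup>2 * U\<^sup>2 * \<sigma>\<^sup>2 * real (card S) / compat_sq X L S)"
  proof (cases "\<sigma> = 0")
    \<comment> \<open>Without noise the bound on \<open>\<beta>0\<close> forces it to be 0, and then
      \<open>basic\<close> does the same for \<open>\<beta>hat\<close>.\<close>
    case True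
    have "lam * l1_norm \<beta>0 \<le> 0"
      using b0 True assms(4,6) by (simp add: mult_le_0_iff)
    then have "l1_norm \<beta>0 = 0" "l1_norm \<beta>hat = 0"
      using basic True a assms(4) l1_norm_nonneg [of \<beta>0] l1_norm_nonneg [of \<beta>hat]
      by (smt (verit) mult_le_0_iff)+
    then have "P = 0"
      by (simp add: P_def l1_norm_eq_0_iff norm_n_eq_0_iff)
    then show ?thesis by simp
  next
    case False
    then have \<sigma>pos: "0 < \<sigma>"
      using \<sigma> by simp
    have "lam * l1_norm \<beta>0 \<le> \<sigma> * (U - 1)"
      using b0 assms(6) by (simp add: U_def field_simps)
    moreover have "0 \<le> lam * l1_norm \<beta>hat"
      using assms(4) l1_norm_nonneg [of \<beta>hat] by simp
    ultimately have a_upper: "a \<le> U * \<sigma>"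
      using basic by (simp add: algebra_simps)
    have a_lower: "\<eta> * \<sigma> \<le> a"
    proof -
      have "\<sigma>\<^sup>2 - inner_n \<epsilon> (X *v (\<beta>hat - \<beta>0)) = inner_n \<epsilon> r"
        by (simp add: r\<epsilon> inner_n_simps \<sigma>_def norm_n_power2)
      also have "\<dots> \<le> \<sigma> * a"
        by (simp add: inner_n_le_norm_n \<sigma>_def a_def)
      finally have "\<sigma>\<^sup>2 \<le> \<sigma> * a + lam0 * \<sigma> * l1_norm (\<beta>hat - \<beta>0)"
        using dual [of "\<beta>hat - \<beta>0"] by linarith
      then have "\<sigma> * \<sigma> \<le> \<sigma> * (a + lam0 * l1_norm (\<beta>hat - \<beta>0))"
        by (simp add: power2_eq_square algebra_simps)
      then have "\<sigma> \<le> a + lam0 * l1_norm (\<beta>hat - \<beta>0)"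
        using \<sigma>pos by simp
      also have "\<dots> \<le> a + lam0 * (l1_norm \<beta>hat + l1_norm \<beta>0)"
        using assms(6) by (simp add: l1_norm_triangle_diff)
      \<comment> \<open>The factor \<open>lam\<close> makes \<open>lam * l1_norm \<beta>hat\<close>
        appear, which \<open>basic\<close> bounds.\<close>
      finally have "lam * \<sigma> \<le> lam * (a + lam0 * (l1_norm \<beta>hat + l1_norm \<beta>0))"
        using assms(4) by simp
      also have "\<dots> = lam * a + lam0 * (lam * l1_norm \<beta>hat) + lam0 * lam * l1_norm \<beta>0"
        by (simp add: algebra_simps)
      also have "\<dots> \<le> lam * a + lam0 * (\<sigma> + lam * l1_norm \<beta>0 - a) + lam0 * lam * l1_norm \<beta>0"
        using mult_left_mono [OF basic, of lam0] assms(6) by (simp add: algebra_simps)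
      \<comment> \<open>The two copies of \<open>lam0 * lam * l1_norm \<beta>0\<close> are absorbed
        by \<open>b0\<close>, whose term \<open>- lam0 * \<sigma>\<close> cancels the remaining
        \<open>lam0 * \<sigma>\<close>.\<close>
      also have "\<dots> \<le> lam * a + lam * \<eta> * \<sigma> - lam0 * a"
        using b0 by (simp add: algebra_simps)
      also have "\<dots> \<le> lam * (a + \<eta> * \<sigma>)"
        using assms(6) a by (simp add: algebra_simps)
      finally have "\<sigma> \<le> a + \<eta> * \<sigma>"
        using assms(4) by simp
      then have "(1 - \<eta>) * \<sigma> \<le> a"
        by (simp add: algebra_simps)
      moreover have "\<eta> * \<sigma> \<le> (1 - \<eta>) * \<sigma>"
        using \<eta> \<sigma> by (intro mult_right_mono) auto
      ultimately show ?thesis by simp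
    qed
    then have apos: "0 < a"
      using mult_pos_pos [OF \<eta>(1) \<sigma>pos] by simp
    have "inner_n r (X *v (\<beta> - \<beta>hat)) \<le> lam * a * (l1_norm \<beta> - l1_norm \<beta>hat)"
      using sqrt_lasso_optimality [OF assms(5), of \<beta>] assms(4) apos by (simp add: a_def r_def)
    also have "\<dots> \<le> lam * a * (m - m')"
      using l1_norm_diff_le_restr [of \<beta> \<beta>hat] assms(4) a
      by (intro mult_left_mono) (auto simp: S m_def m'_def)
    finally have kkt: "inner_n r (X *v (\<beta> - \<beta>hat)) \<le> lam * a * (m - m')" .
    \<comment> \<open>The noise level is traded for the residual norm, so that noise and penalty
      share the factor \<open>a\<close>.\<close>
    have "lam0 * \<sigma> \<le> lam0 / \<eta> * a"
      using mult_left_mono [OF a_lower, of lam0] assms(6) \<eta> by (simp add: field_simps)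
    then have "lam0 * \<sigma> * (m + m') \<le> lam0 / \<eta> * a * (m + m')"
      using m by (intro mult_right_mono) auto
    then have noise: "inner_n \<epsilon> (X *v (\<beta>hat - \<beta>)) \<le> lam0 / \<eta> * a * (m + m')"
      using dual [of "\<beta>hat - \<beta>"] l1_norm_restr_split [of "\<beta>hat - \<beta>" S] by (simp add: m_def m'_def)
    \<comment> \<open>Polarization: the left side is twice the inner product of
      \<open>X *v (\<beta>hat - \<beta>0)\<close>, which equals \<open>\<epsilon> - r\<close>, with
      \<open>X *v (\<beta>hat - \<beta>)\<close>.\<close>
    have "P\<^sup>2 + Q\<^sup>2 - R\<^sup>2
        = 2 * (inner_n \<epsilon> (X *v (\<beta>hat - \<beta>)) + inner_n r (X *v (\<beta> - \<beta>hat)))"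
      unfolding P_def Q_def R_def r\<epsilon> norm_n_power2 matrix_vector_mult_diff_distrib inner_n_simps
      using inner_n_commute [of "X *v \<beta>" "X *v \<beta>hat"] inner_n_commute [of "X *v \<beta>0" "X *v \<beta>hat"]
        inner_n_commute [of "X *v \<beta>0" "X *v \<beta>"]
      by argo
    also have "\<dots> \<le> 2 * (lam0 / \<eta> * a * (m + m') + lam * a * (m - m'))"
      using kkt noise by simp
    also have "\<dots> = 2 * a * (c * m - c' * m')"
      using \<eta> by (simp add: c_def c'_def field_simps)
    finally have main: "P\<^sup>2 + Q\<^sup>2 - R\<^sup>2 \<le> 2 * a * (c * m - c' * m')" .
    show ?thesis
    \<comment> \<open>Outside the cone, or for empty \<open>S\<close> where \<open>m\<close> is 0,
      the right side of \<open>main\<close> is nonpositive; inside it the compatibility constant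
      applies.\<close>
    proof (cases "S = {} \<or> c * m < c' * m'")
      case True
      then have "c * m \<le> c' * m'"
        using m pos by (auto simp: m_def restr_def l1_norm_def)
      then have "2 * a * (c * m - c' * m') \<le> 0"
        using a by (simp add: mult_nonneg_nonpos)
      then have "P\<^sup>2 + Q\<^sup>2 - R\<^sup>2 \<le> 0"
        using main by linarith
      then show ?thesis
        using zero_le_power2 [of Q] by linarith
    next
      case False
      then have "m' \<le> L * m"
        using pos by (simp add: L field_simps)
      then have compat: "compat_sq X L S * m\<^sup>2 \<le> real (card S) * Q\<^sup>2"
        unfolding m_def m'_def Q_def by (rule compat_sq_mult_l1_norm_le)
      have "P\<^sup>2 \<le> R\<^sup>2 + c\<^sup>2 * U\<^sup>2 * \<sigma>\<^sup>2 * real (card S) / compat_sq X L S"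
        if "compat_sq X L S \<noteq> 0"
      proof -
        define k where "k = compat_sq X L S / real (card S)"
        have card: "0 < real (card S)"
          using False by (simp add: card_gt_0_iff)
        have k: "0 < k"
          using that False pos compat_sq_nonneg [of S L X] card by (simp add: k_def less_le)
        have "k * m\<^sup>2 \<le> Q\<^sup>2"
          using compat card by (simp add: k_def field_simps)
        moreover have "2 * a * (c * m - c' * m') \<le> 2 * (a * c) * m"
          using a m pos by (simp add: algebra_simps)
        \<comment> \<open>Weighted so that \<open>k * m\<^sup>2\<close> is absorbed by
          \<open>Q\<^sup>2\<close> in \<open>main\<close>; what remains becomes the compatibility
          term once \<open>a\<close> is replaced by its bound \<open>U * \<sigma>\<close>.\<close>
        moreover have "2 * (a * c) * m \<le> k * m\<^sup>2 + (a * c)\<^sup>2 / k"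
        proof -
          have "0 \<le> (a * c - k * m)\<^sup>2 / k"
            using k by simp
          also have "\<dots> = k * m\<^sup>2 + (a * c)\<^sup>2 / k - 2 * (a * c) * m"
            using k by (simp add: power2_diff power_mult_distrib field_simps power2_eq_square)
          finally show ?thesis by simp
        qed
        moreover have "(a * c)\<^sup>2 / k \<le> (U * \<sigma> * c)\<^sup>2 / k"
          using a_upper a pos k by (intro divide_right_mono power_mono mult_right_mono) auto
        ultimately have "P\<^sup>2 \<le> R\<^sup>2 + (U * \<sigma> * c)\<^sup>2 / k"
          using main by linarith
        then show ?thesis
          by (simp add: k_def power_mult_distrib ac_simps)
      qed
      then show ?thesis
        using False by blast
    qed
  qed
  moreover have "0 \<le> compat_term X L S (c\<^sup>2 * U\<^sup>2 * \<sigma>\<^sup>2)"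
    using compat_sq_nonneg [of S L X] pos by (auto simp: compat_term_def)
  ultimately have "ereal (P\<^sup>2) \<le> ereal (R\<^sup>2) + compat_term X L S (c\<^sup>2 * U\<^sup>2 * \<sigma>\<^sup>2)"
  proof (elim disjE)
    assume "P\<^sup>2 \<le> R\<^sup>2" and "0 \<le> compat_term X L S (c\<^sup>2 * U\<^sup>2 * \<sigma>\<^sup>2)"
    then show ?thesis
      using add_mono [of "ereal (P\<^sup>2)" "ereal (R\<^sup>2)" 0] by simp
  qed (auto simp: compat_term_def)
  then show "ereal ((norm_n (X *v (\<beta>hat - \<beta>0)))\<^sup>2) \<le>
      ereal ((norm_n (X *v (\<beta> - \<beta>0)))\<^sup>2) + compat_term X L S
        (((lam * \<eta> + lam0) / \<eta>)\<^sup>2 * ((lam * \<eta> + lam0) / (2 * lam0))\<^sup>2 * (norm_n \<epsilon>)\<^sup>2)"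
    by (simp add: P_def R_def c_def U_def \<sigma>_def)
qed

end
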